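(* Let $X\in\mathbb{R}^{n\times p}$, $\beta^0\in\mathbb{R}^p$, $\epsilon\in\mathbb{R}^n$ and $Y=X\beta^0+\epsilon$. Let $\lambda_0\ge 2\|\epsilon'X/n\|_\infty$ and let $\lambda>0$ satisfy $\lambda\ge2\lambda_0$. Let $\hat\beta$ be an optimal solution of the Lasso problem $\min_{\beta\in\mathbb{R}^p}\{\frac1n\|Y-X\beta\|_2^2+\lambda\|\beta\|_1\}$. (A) Then $$\frac1n\|X\hat\beta-X\beta^0\|_2^2\le\frac{3\lambda}{2}\|\beta^0\|_1 .$$ (B) Let $S=\{j:\beta^0_j\neq0\}$ be nonempty, $s=|S|$, and suppose $X$ satisfies the $(3,S)$ compatibility condition, i.e. $\phi_{comp}(3,S)>0$. Then $$\frac1n\|X\hat\beta-X\beta^0\|_2^2\le\frac{9\lambda^2 s}{4\,\phi_{comp}^2(3,S)} .$$ In particular, for the choice $\lambda=\kappa\,\sigma\sqrt{\frac{\log p}{n}}$ with a constant $\kappa>0$, the right-hand side in (A) equals $\frac{3\kappa}{2}\,\sigma\|\beta^0\|_1\sqrt{\frac{\log p}{n}}$ and the right-hand side in (B) equals $\frac{9\kappa^2}{4}\,\frac{\sigma^2\log p}{n}\,\frac{s}{\phi_{comp}^2(3,S)}$.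
   Context: The design matrix $X$ is fixed, and in the underlying model $\epsilon\sim N_n(0,\sigma^2 I)$ with $\sigma>0$; the bounds are asserted on the event that $\lambda_0\ge2\|\epsilon'X/n\|_\infty$. A prime denotes transpose. For $\Delta\in\mathbb{R}^p$ and $S\subset\{1,\dots,p\}$, $\Delta_S\in\mathbb{R}^p$ agrees with $\Delta$ on $S$ and is zero outside $S$; $S^c$ is the complement of $S$. $\|\cdot\|_1,\|\cdot\|_2,\|\cdot\|_\infty$ are the usual norms. For $L>0$ the compatibility constant $\phi_{comp}(L,S)\ge0$ is defined, with $s=|S|$, by $$\phi_{comp}^2(L,S)=\min\Big\{\frac{\frac1n\|X\Delta\|_2^2\,s}{\|\Delta_S\|_1^2}:\ \Delta\in\mathbb{R}^p,\ \|\Delta_{S^c}\|_1\le L\|\Delta_S\|_1\ne0\Big\}.$$ *)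

theory Defs
  imports "HOL-Analysis.Analysis"
begin

definition l1_norm :: "real ^ 'p \<Rightarrow> real" where
  "l1_norm v = (\<Sum>j\<in>UNIV. \<bar>v $ j\<bar>)"

definition vec_restrict :: "real ^ 'p \<Rightarrow> 'p set \<Rightarrow> real ^ 'p" where
  "vec_restrict v S = (\<chi> j. if j \<in> S then v $ j else 0)"

definition lasso_objective ::
  "real ^ 'p ^ 'n \<Rightarrow> real ^ 'n \<Rightarrow> real \<Rightarrow> real ^ 'p \<Rightarrow> real" where
  "lasso_objective X Y lam b =
     1 / real CARD('n) * (norm (Y - X *v b))\<^sup>2 + lam * l1_norm b"

definition lasso_solution ::
  "real ^ 'p ^ 'n \<Rightarrow> real ^ 'n \<Rightarrow> real \<Rightarrow> real ^ 'p \<Rightarrow> bool" where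
  "lasso_solution X Y lam b \<longleftrightarrow> is_arg_min (lasso_objective X Y lam) (\<lambda>_. True) b"

definition compat_cone :: "real \<Rightarrow> 'p set \<Rightarrow> (real ^ 'p) set" where
  "compat_cone L S =
     {\<Delta>. l1_norm (vec_restrict \<Delta> (- S)) \<le> L * l1_norm (vec_restrict \<Delta> S) \<and>
         l1_norm (vec_restrict \<Delta> S) \<noteq> 0}"

definition compat_ratio :: "real ^ 'p ^ 'n \<Rightarrow> 'p set \<Rightarrow> real ^ 'p \<Rightarrow> real" where
  "compat_ratio X S \<Delta> =
     (1 / real CARD('n) * (norm (X *v \<Delta>))\<^sup>2 * real (card S)) /
     (l1_norm (vec_restrict \<Delta> S))\<^sup>2"

text \<open>The infimum below is a minimum whenever \<open>S\<close> is nonempty and \<open>L\<close> is positive; see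
  \<open>phi_comp_is_min\<close>. For empty \<open>S\<close> the cone is empty and the value is meaningless.\<close>

definition phi_comp :: "real ^ 'p ^ 'n \<Rightarrow> real \<Rightarrow> 'p set \<Rightarrow> real" where
  "phi_comp X L S = sqrt (Inf (compat_ratio X S ` compat_cone L S))"

lemma l1_norm_scaleR: "l1_norm (c *\<^sub>R v) = \<bar>c\<bar> * l1_norm v"
  by (simp add: l1_norm_def abs_mult sum_distrib_left)

lemma vec_restrict_scaleR: "vec_restrict (c *\<^sub>R v) S = c *\<^sub>R vec_restrict v S"
  by (simp add: vec_restrict_def vec_eq_iff)

lemma l1_norm_split: "l1_norm v = l1_norm (vec_restrict v S) + l1_norm (vec_restrict v (- S))"
  unfolding l1_norm_def vec_restrict_def sum.distrib[symmetric]
  by (rule sum.cong) auto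

lemma l1_norm_nonneg: "l1_norm v \<ge> 0"
  by (simp add: l1_norm_def sum_nonneg)

lemma continuous_on_l1_restrict: "continuous_on A (\<lambda>v. l1_norm (vec_restrict v S))"
proof -
  have "continuous_on A (\<lambda>v. \<bar>vec_restrict v S $ j\<bar>)" for j
    by (cases "j \<in> S") (auto simp: vec_restrict_def intro!: continuous_intros)
  then show ?thesis
    unfolding l1_norm_def by (intro continuous_on_sum)
qed

lemma phi_comp_is_min:
  fixes X :: "real ^ 'p ^ 'n"
  assumes "S \<noteq> {}" "L > 0"
  shows "phi_comp X L S \<ge> 0"
    and "\<exists>\<Delta>\<in>compat_cone L S. compat_ratio X S \<Delta> = (phi_comp X L S)\<^sup>2"
    and "\<And>\<Delta>. \<Delta> \<in> compat_cone L S \<Longrightarrow> (phi_comp X L S)\<^sup>2 \<le> compat_ratio X S \<Delta>"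
proof -
  define K where "K = {\<Delta> :: real ^ 'p. l1_norm (vec_restrict \<Delta> S) = 1 \<and>
                                    l1_norm (vec_restrict \<Delta> (- S)) \<le> L}"
  have "K = (\<lambda>v. l1_norm (vec_restrict v S)) -` {1} \<inter>
            (\<lambda>v. l1_norm (vec_restrict v (- S))) -` {..L}"
    by (auto simp: K_def)
  then have "closed K"
    by (simp add: closed_Int closed_vimage continuous_on_l1_restrict)
  moreover have "norm v \<le> 1 + L" if "v \<in> K" for v
    using norm_le_l1_cart[of v] l1_norm_split[of v S] that by (simp add: K_def l1_norm_def)
  then have "bounded K"
    by (auto simp: bounded_iff)
  ultimately have "compact K"
    by (simp add: compact_eq_bounded_closed)
  obtain j where j: "j \<in> S"
    using assms by auto
  have "axis j 1 \<in> K"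
  proof -
    have "vec_restrict (axis j 1) S = (axis j 1 :: real ^ 'p)"
      and "vec_restrict (axis j 1) (- S) = (0 :: real ^ 'p)"
      using j by (auto simp: vec_restrict_def vec_eq_iff axis_def)
    then show ?thesis
      using assms by (simp add: K_def l1_norm_def axis_def if_distrib cong: if_cong)
  qed
  then have "K \<noteq> {}" by auto
  have "continuous_on K (compat_ratio X S)"
    unfolding compat_ratio_def
    by (intro continuous_intros continuous_on_l1_restrict
        linear_continuous_on_compose[OF continuous_on_id matrix_vector_mul_linear])
      (auto simp: K_def)
  with continuous_attains_inf[OF \<open>compact K\<close> \<open>K \<noteq> {}\<close>] obtain d
    where d: "d \<in> K" "\<And>v. v \<in> K \<Longrightarrow> compat_ratio X S d \<le> compat_ratio X S v"
    by blast
  have dc: "d \<in> compat_cone L S"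
    using d by (simp add: K_def compat_cone_def)
  have min: "compat_ratio X S d \<le> compat_ratio X S v" if v: "v \<in> compat_cone L S" for v
  proof -
    define t where "t = l1_norm (vec_restrict v S)"
    have t: "t > 0"
      using v l1_norm_nonneg[of "vec_restrict v S"] by (simp add: compat_cone_def t_def)
    have "(1 / t) *\<^sub>R v \<in> K"
      using v t by (simp add: K_def compat_cone_def vec_restrict_scaleR l1_norm_scaleR
          t_def[symmetric] field_simps)
    moreover have "compat_ratio X S ((1 / t) *\<^sub>R v) = compat_ratio X S v"
      using t unfolding compat_ratio_def vec_restrict_scaleR l1_norm_scaleR t_def[symmetric]
      by (simp add: matrix_vector_mult_scaleR power_mult_distrib field_simps)
    ultimately show ?thesis
      using d(2) by metis
  qed
  have "Inf (compat_ratio X S ` compat_cone L S) = compat_ratio X S d"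
    using dc min by (intro cInf_eq_minimum) auto
  moreover have "compat_ratio X S d \<ge> 0"
    by (simp add: compat_ratio_def)
  ultimately have *: "phi_comp X L S \<ge> 0" "(phi_comp X L S)\<^sup>2 = compat_ratio X S d"
    by (simp_all add: phi_comp_def)
  then show "phi_comp X L S \<ge> 0"
    and "\<exists>\<Delta>\<in>compat_cone L S. compat_ratio X S \<Delta> = (phi_comp X L S)\<^sup>2"
    and "\<And>\<Delta>. \<Delta> \<in> compat_cone L S \<Longrightarrow> (phi_comp X L S)\<^sup>2 \<le> compat_ratio X S \<Delta>"
    using dc min by auto
qed

end

theory Submission
  imports Defs
begin

text \<open>
  Write \<open>\<Delta> = \<beta>hat - \<beta>0\<close> and \<open>E = \<parallel>X \<Delta>\<parallel>\<^sup>2 / n\<close>. Comparing the objective at \<open>\<beta>hat\<close> and at \<open>\<beta>0\<close> and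
  bounding the noise term by the duality of the l1 and the maximum norm gives the basic inequality
  \<open>E + \<lambda> \<parallel>\<beta>hat\<parallel>\<^sub>1 \<le> \<lambda> / 2 * \<parallel>\<Delta>\<parallel>\<^sub>1 + \<lambda> \<parallel>\<beta>0\<parallel>\<^sub>1\<close>. The triangle inequality for \<open>\<Delta>\<close> yields (A). Splitting
  over \<open>S\<close> and its complement \<open>T\<close> instead yields \<open>E + \<lambda> / 2 * \<parallel>\<Delta>\<^sub>T\<parallel>\<^sub>1 \<le> 3 \<lambda> / 2 * \<parallel>\<Delta>\<^sub>S\<parallel>\<^sub>1\<close>, which
  puts \<open>\<Delta>\<close> in the cone with \<open>L = 3\<close> and bounds \<open>E\<close> by \<open>3 \<lambda> / 2 * \<parallel>\<Delta>\<^sub>S\<parallel>\<^sub>1\<close>; compatibility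
  bounds \<open>\<parallel>\<Delta>\<^sub>S\<parallel>\<^sub>1\<^sup>2\<close> by \<open>E s / \<phi>\<^sup>2\<close>, and one factor of \<open>E\<close> cancels.
\<close>

lemma l1_norm_diff_le: "l1_norm (v - w) \<le> l1_norm v + l1_norm w"
  unfolding l1_norm_def sum.distrib[symmetric]
  by (intro sum_mono) (simp add: abs_triangle_ineq4)

lemma inner_le_infnorm_l1_norm:
  fixes v w :: "real ^ 'p"
  shows "v \<bullet> w \<le> infnorm v * l1_norm w"
proof -
  have "v \<bullet> w = (\<Sum>j\<in>UNIV. v $ j * w $ j)"
    by (simp add: inner_vec_def)
  also have "\<dots> \<le> (\<Sum>j\<in>UNIV. infnorm v * \<bar>w $ j\<bar>)"
  proof (rule sum_mono)
    fix j
    have "v $ j * w $ j \<le> \<bar>v $ j\<bar> * \<bar>w $ j\<bar>"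
      by (metis abs_ge_self abs_mult)
    also have "\<dots> \<le> infnorm v * \<bar>w $ j\<bar>"
      by (intro mult_right_mono component_le_infnorm_cart) simp
    finally show "v $ j * w $ j \<le> infnorm v * \<bar>w $ j\<bar>" .
  qed
  finally show ?thesis
    by (simp add: l1_norm_def sum_distrib_left)
qed

text \<open>The 4 combines the factor 2 in the bound on \<open>lam0\<close> with the factor 2 in
  \<open>lam \<ge> 2 * lam0\<close>. The cross term of the expanded square, which carries its own
  factor 2, then costs at most \<open>lam / 2 * l1_norm (b - \<beta>0)\<close>.\<close>

lemma lasso_basic_inequality:
  fixes X :: "real ^ 'p ^ 'n"
  assumes Y: "Y = X *v \<beta>0 + \<epsilon>"
    and noise: "lam \<ge> 4 * infnorm ((1 / real CARD('n)) *\<^sub>R (\<epsilon> v* X))"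
    and sol: "lasso_solution X Y lam b"
  shows "1 / real CARD('n) * (norm (X *v (b - \<beta>0)))\<^sup>2 + lam * l1_norm b
    \<le> lam / 2 * l1_norm (b - \<beta>0) + lam * l1_norm \<beta>0"
proof -
  define \<Delta> where "\<Delta> = b - \<beta>0"
  define c where "c = 1 / real CARD('n)"
  have res: "Y - X *v b = \<epsilon> - X *v \<Delta>" "Y - X *v \<beta>0 = \<epsilon>"
    by (simp_all add: Y \<Delta>_def matrix_vector_mult_diff_distrib)
  have "lasso_objective X Y lam b \<le> lasso_objective X Y lam \<beta>0"
    using sol by (auto simp: lasso_solution_def is_arg_min_linorder)
  then have opt: "c * (norm (\<epsilon> - X *v \<Delta>))\<^sup>2 + lam * l1_norm b \<le> c * (norm \<epsilon>)\<^sup>2 + lam * l1_norm \<beta>0"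
    unfolding lasso_objective_def res c_def .
  have "(norm (\<epsilon> - X *v \<Delta>))\<^sup>2 = (norm \<epsilon>)\<^sup>2 - 2 * (\<epsilon> \<bullet> (X *v \<Delta>)) + (norm (X *v \<Delta>))\<^sup>2"
    by (simp add: power2_norm_eq_inner algebra_simps inner_commute)
  then have expand: "c * (norm (\<epsilon> - X *v \<Delta>))\<^sup>2
      = c * (norm \<epsilon>)\<^sup>2 - 2 * (c * (\<epsilon> \<bullet> (X *v \<Delta>))) + c * (norm (X *v \<Delta>))\<^sup>2"
    by (simp only: distrib_left right_diff_distrib mult.left_commute)
  have "c * (\<epsilon> \<bullet> (X *v \<Delta>)) = (c *\<^sub>R (\<epsilon> v* X)) \<bullet> \<Delta>"
    by (simp add: dot_lmul_matrix)
  also have "\<dots> \<le> infnorm (c *\<^sub>R (\<epsilon> v* X)) * l1_norm \<Delta>"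
    by (rule inner_le_infnorm_l1_norm)
  also have "\<dots> \<le> lam / 4 * l1_norm \<Delta>"
    using noise by (intro mult_right_mono l1_norm_nonneg) (simp add: c_def)
  finally show ?thesis
    using opt expand unfolding \<Delta>_def c_def by linarith
qed

text \<open>Holds coordinatewise: on \<open>S\<close> by the reverse triangle inequality, off
  \<open>S\<close> with equality because \<open>\<beta>0\<close> vanishes there.\<close>

lemma l1_norm_support_diff:
  fixes \<beta>0 b :: "real ^ 'p"
  assumes "S = {j. \<beta>0 $ j \<noteq> 0}"
  shows "l1_norm \<beta>0 - l1_norm b
    \<le> l1_norm (vec_restrict (b - \<beta>0) S) - l1_norm (vec_restrict (b - \<beta>0) (- S))"
  unfolding l1_norm_def vec_restrict_def sum_subtractf[symmetric]
  by (intro sum_mono) (auto simp: assms)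

lemma compat_bound:
  fixes X :: "real ^ 'p ^ 'n"
  assumes "S \<noteq> {}" "L > 0" "\<Delta> \<in> compat_cone L S"
  shows "(phi_comp X L S)\<^sup>2 * (l1_norm (vec_restrict \<Delta> S))\<^sup>2
    \<le> 1 / real CARD('n) * (norm (X *v \<Delta>))\<^sup>2 * real (card S)"
proof -
  have "(l1_norm (vec_restrict \<Delta> S))\<^sup>2 > 0"
    using assms(3) by (simp add: compat_cone_def)
  then show ?thesis
    using phi_comp_is_min(3)[OF assms, of X] by (simp add: compat_ratio_def pos_le_divide_eq mult_ac)
qed

theorem theorem5:
  fixes X :: "real ^ 'p ^ 'n"
    and \<beta>0 \<beta>hat :: "real ^ 'p"
    and \<epsilon> Y :: "real ^ 'n"
    and lam0 lam :: real
    and S :: "'p set"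
  assumes "Y = X *v \<beta>0 + \<epsilon>"
    and "lam0 \<ge> 2 * infnorm ((1 / real CARD('n)) *\<^sub>R (\<epsilon> v* X))"
    and "lam > 0"
    and "lam \<ge> 2 * lam0"
    and "lasso_solution X Y lam \<beta>hat"
    and "S = {j. \<beta>0 $ j \<noteq> 0}"
  shows "1 / real CARD('n) * (norm (X *v \<beta>hat - X *v \<beta>0))\<^sup>2 \<le> 3 * lam / 2 * l1_norm \<beta>0
    \<and> (S \<noteq> {} \<and> phi_comp X 3 S > 0 \<longrightarrow>
        1 / real CARD('n) * (norm (X *v \<beta>hat - X *v \<beta>0))\<^sup>2
          \<le> 9 * lam\<^sup>2 * real (card S) / (4 * (phi_comp X 3 S)\<^sup>2))
    \<and> (\<forall>\<kappa> \<sigma> :: real. \<kappa> > 0 \<and> \<sigma> > 0 \<and>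
        lam = \<kappa> * \<sigma> * sqrt (ln (real CARD('p)) / real CARD('n)) \<longrightarrow>
          3 * lam / 2 * l1_norm \<beta>0
            = 3 * \<kappa> / 2 * \<sigma> * l1_norm \<beta>0 * sqrt (ln (real CARD('p)) / real CARD('n))
        \<and> (S \<noteq> {} \<and> phi_comp X 3 S > 0 \<longrightarrow>
            9 * lam\<^sup>2 * real (card S) / (4 * (phi_comp X 3 S)\<^sup>2)
              = 9 * \<kappa>\<^sup>2 / 4 * (\<sigma>\<^sup>2 * ln (real CARD('p)) / real CARD('n))
                  * (real (card S) / (phi_comp X 3 S)\<^sup>2)))"
proof -
  define E where "E = 1 / real CARD('n) * (norm (X *v (\<beta>hat - \<beta>0)))\<^sup>2"
  define \<Delta> where "\<Delta> = \<beta>hat - \<beta>0"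
  define a where "a = l1_norm (vec_restrict \<Delta> S)"
  define r where "r = l1_norm (vec_restrict \<Delta> (- S))"
  have E0: "E \<ge> 0"
    by (simp add: E_def)
  have E: "1 / real CARD('n) * (norm (X *v \<beta>hat - X *v \<beta>0))\<^sup>2 = E"
    by (simp add: E_def matrix_vector_mult_diff_distrib)
  have "lam \<ge> 4 * infnorm ((1 / real CARD('n)) *\<^sub>R (\<epsilon> v* X))"
    using assms(2,4) by linarith
  then have basic: "E + lam * l1_norm \<beta>hat \<le> lam / 2 * l1_norm \<Delta> + lam * l1_norm \<beta>0"
    unfolding E_def \<Delta>_def by (rule lasso_basic_inequality[OF assms(1) _ assms(5)])
  have A: "E \<le> 3 * lam / 2 * l1_norm \<beta>0"
  proof -
    have "lam / 2 * l1_norm \<Delta> \<le> lam / 2 * (l1_norm \<beta>hat + l1_norm \<beta>0)"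
      using assms(3) l1_norm_diff_le by (intro mult_left_mono) (auto simp: \<Delta>_def)
    \<comment> \<open>Half of the penalty of \<open>\<beta>hat\<close> remains on the left and is
      dropped.\<close>
    moreover have "lam * l1_norm \<beta>hat \<ge> 0"
      using assms(3) by (simp add: l1_norm_nonneg)
    ultimately show ?thesis
      using basic by (simp add: algebra_simps)
  qed
  have B: "E \<le> 9 * lam\<^sup>2 * real (card S) / (4 * (phi_comp X 3 S)\<^sup>2)"
    if S: "S \<noteq> {}" and phi: "phi_comp X 3 S > 0"
  \<comment> \<open>Positivity of \<open>E\<close> is needed twice: it forces
    \<open>a \<noteq> 0\<close>, as the cone demands, and it lets a factor \<open>E\<close> be
    cancelled at the end.\<close>
  proof (cases "E = 0")
    case True
    then show ?thesis by simp
  next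
    case False
    then have Epos: "E > 0"
      using E0 by simp
    have "lam * (l1_norm \<beta>0 - l1_norm \<beta>hat) \<le> lam * (a - r)"
      using assms(3) l1_norm_support_diff[OF assms(6), of \<beta>hat]
      by (intro mult_left_mono) (auto simp: a_def r_def \<Delta>_def)
    \<comment> \<open>The coefficients are \<open>lam / 2 + lam\<close> for \<open>a\<close> and
      \<open>lam / 2 - lam\<close> for \<open>r\<close>; their ratio is the cone constant 3.\<close>
    then have key: "E + lam / 2 * r \<le> 3 * lam / 2 * a"
      using basic
      unfolding l1_norm_split[of \<Delta> S, folded a_def r_def] right_diff_distrib distrib_left
      by linarith
    have a0: "a \<ge> 0" and r0: "r \<ge> 0"
      by (simp_all add: a_def r_def l1_norm_nonneg)
    have "lam / 2 * r \<ge> 0"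
      using assms(3) r0 by simp
    then have Ea: "E \<le> 3 * lam / 2 * a"
      using key by linarith
    then have "a \<noteq> 0"
      using Epos by auto
    moreover have "lam / 2 * r \<le> lam / 2 * (3 * a)"
      using key Epos by (simp add: algebra_simps)
    then have "r \<le> 3 * a"
      using assms(3) by simp
    ultimately have "\<Delta> \<in> compat_cone 3 S"
      by (simp add: compat_cone_def a_def r_def)
    then have compat: "(phi_comp X 3 S)\<^sup>2 * a\<^sup>2 \<le> E * real (card S)"
      using compat_bound[OF S, of 3 \<Delta> X] by (simp add: a_def E_def \<Delta>_def)
    \<comment> \<open>Squaring \<open>Ea\<close> produces the \<open>a\<^sup>2\<close> that
      compatibility controls.\<close>
    have "(phi_comp X 3 S)\<^sup>2 * E\<^sup>2 \<le> (phi_comp X 3 S)\<^sup>2 * (3 * lam / 2 * a)\<^sup>2"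
      using Ea E0 by (intro mult_left_mono power_mono) auto
    also have "\<dots> = 9 * lam\<^sup>2 / 4 * ((phi_comp X 3 S)\<^sup>2 * a\<^sup>2)"
      by (simp add: power2_eq_square)
    also have "\<dots> \<le> 9 * lam\<^sup>2 / 4 * (E * real (card S))"
      using compat by (intro mult_left_mono) auto
    finally have "E * ((phi_comp X 3 S)\<^sup>2 * E) \<le> E * (9 * lam\<^sup>2 / 4 * real (card S))"
      by (simp add: power2_eq_square algebra_simps)
    then have "(phi_comp X 3 S)\<^sup>2 * E \<le> 9 * lam\<^sup>2 / 4 * real (card S)"
      using Epos by simp
    then show ?thesis
      using phi by (simp add: field_simps)
  qed
  \<comment> \<open>The square undoes the root since \<open>CARD('p) \<ge> 1\<close> makes the
    logarithm nonnegative.\<close>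
  have "(sqrt (ln (real CARD('p)) / real CARD('n)))\<^sup>2 = ln (real CARD('p)) / real CARD('n)"
    by (simp add: Suc_leI)
  then have C: "lam\<^sup>2 = \<kappa>\<^sup>2 * (\<sigma>\<^sup>2 * ln (real CARD('p)) / real CARD('n))"
    if "lam = \<kappa> * \<sigma> * sqrt (ln (real CARD('p)) / real CARD('n))" for \<kappa> \<sigma>
    unfolding that power_mult_distrib by simp
  show ?thesis
    unfolding E
  proof (intro conjI allI impI)
    fix \<kappa> \<sigma> :: real
    assume "\<kappa> > 0 \<and> \<sigma> > 0 \<and> lam = \<kappa> * \<sigma> * sqrt (ln (real CARD('p)) / real CARD('n))"
    then have lam: "lam = \<kappa> * \<sigma> * sqrt (ln (real CARD('p)) / real CARD('n))"
      by blast
    show "3 * lam / 2 * l1_norm \<beta>0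
        = 3 * \<kappa> / 2 * \<sigma> * l1_norm \<beta>0 * sqrt (ln (real CARD('p)) / real CARD('n))"
      by (simp add: lam)
    show "9 * lam\<^sup>2 * real (card S) / (4 * (phi_comp X 3 S)\<^sup>2)
        = 9 * \<kappa>\<^sup>2 / 4 * (\<sigma>\<^sup>2 * ln (real CARD('p)) / real CARD('n))
            * (real (card S) / (phi_comp X 3 S)\<^sup>2)"
      unfolding C[OF lam] by simp
  qed (use A B in auto)
qed

end
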